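(* Let $p\in(0,1)$. Suppose that $F\in \mathcal{F}^{+}_{1}$, and let $F_1,F_2,\ldots \in \mathcal{F}^{+}_{1}$ be any sequence of (possibly random) cdf's that are unbiased estimators of $F$, that is, $\mathbb{E}( F_n(x) ) =F(x)$ for all $x\in \mathbb{R}$ and $n\in \mathbb{N}$, and such that $\mathbb{E}( F_n^{-1}(p) ) \in \mathbb{R}$ for all $n\in \mathbb{N}$. Then $\int_p^1 F_n^{-1}(u)\,du$ is a non-positively biased estimator of $\int_p^1 F^{-1}(u)\,du$, that is, for every $n\in\mathbb{N}$, $$\mathbb{E}\bigg(\int_p^1 F_n^{-1}(u)\,du\bigg)-\int_p^1 F^{-1}(u)\,du\le 0 .$$
   Context: The quantile function of a cdf $F$ is $F^{-1}(u)=\inf\{x\in\mathbb{R}: F(x)\ge u\}$ for $u\in(0,1]$ and $F^{-1}(0)=\lim_{u\downarrow 0}F^{-1}(u)$. The class $\mathcal{F}^{+}_{1}$ consists of all (deterministic) cdf's $F$ for which $\int_p^1 F^{-1}(u)\,du$ is finite (for $p\in(0,1)$); equivalently, $\mathbb{E}(X^{+})<\infty$ for $X\sim F$, where $X^{+}=X\vee 0$. The cdf $F$ is deterministic. The $F_n$ may be random: on an underlying probability space $(\Omega,\mathcal{A},\mathbb{P})$, $F_n:\Omega\times\mathbb{R}\to[0,1]$ is jointly measurable and $F_n(\omega,\cdot)$ is a cdf for almost all $\omega$; $F_n\in\mathcal{F}^{+}_{1}$ means that $F_n(\omega,\cdot)\in\mathcal{F}^{+}_{1}$ for almost all $\omega$.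 $\mathbb{E}(F_n^{-1}(p))\in\mathbb{R}$ means that this expectation exists and is finite. *)

theory Defs
  imports "HOL-Probability.Probability"
begin

definition is_cdf :: "(real \<Rightarrow> real) \<Rightarrow> bool" where
  "is_cdf F \<longleftrightarrow> (\<exists>\<mu>. real_distribution \<mu> \<and> F = cdf \<mu>)"

(* Extended-real valued: at u = 1 the infimum may be taken over the empty set (value \<infinity>),
   and the limit at u = 0 may be -\<infinity>. For a cdf, the values on (0, 1) are finite. *)
definition quantile :: "(real \<Rightarrow> real) \<Rightarrow> real \<Rightarrow> ereal" where
  "quantile F u =
     (if u = 0 then Lim (at_right 0) (\<lambda>v::real. INF x\<in>{x. F x \<ge> v}. ereal x)
      else (INF x\<in>{x. F x \<ge> u}. ereal x))"

definition upper_quantile_integral :: "(real \<Rightarrow> real) \<Rightarrow> real \<Rightarrow> real" where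
  "upper_quantile_integral F p = (LBINT u:{p<..<1}. real_of_ereal (quantile F u))"

(* For a cdf F the quantile function is bounded below on (p, 1), so its integral there always
   exists in (-\<infinity>, \<infinity>] and is finite exactly when the function is integrable. *)
definition cdfs_plus :: "(real \<Rightarrow> real) set" where
  "cdfs_plus = {F. is_cdf F \<and>
     (\<forall>p\<in>{0<..<1}. set_integrable lborel {p<..<1} (\<lambda>u. real_of_ereal (quantile F u)))}"

definition random_cdf :: "'a measure \<Rightarrow> ('a \<Rightarrow> real \<Rightarrow> real) \<Rightarrow> bool" where
  "random_cdf M G \<longleftrightarrow>
     (\<lambda>(\<omega>, x). G \<omega> x) \<in> borel_measurable (M \<Otimes>\<^sub>M borel) \<and>
     (\<forall>\<omega>\<in>space M. \<forall>x. G \<omega> x \<in> {0..1}) \<and>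
     (AE \<omega> in M. is_cdf (G \<omega>))"

(* Functionals of a random cdf are meaningful only almost surely: on the exceptional null set
   G \<omega> is arbitrary, so \<omega> \<mapsto> T (G \<omega>) may fail to be measurable there. Their expectations are
   therefore taken over the completion, where null sets do not matter; for M-measurable
   functions this is the expectation over M. *)
abbreviation integrable_as :: "'a measure \<Rightarrow> ('a \<Rightarrow> real) \<Rightarrow> bool" where
  "integrable_as M X \<equiv> integrable (completion M) X"

abbreviation expectation_as :: "'a measure \<Rightarrow> ('a \<Rightarrow> real) \<Rightarrow> real" where
  "expectation_as M X \<equiv> integral\<^sup>L (completion M) X"

end

theory Submission
  imports Defs
begin

text \<open>
  Write \<open>T G\<close> for the integral of the quantile function of \<open>G\<close> over \<open>(p, 1)\<close>. By Tonelli,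
  \<open>T G \<le> (1 - p) * c + (\<integral>x\<in>{c..}. 1 - G x)\<close> for every real \<open>c\<close>, with equality when \<open>c\<close> is
  the \<open>p\<close>-quantile of \<open>G\<close>. The right-hand side is affine in \<open>G\<close>. Choosing \<open>c\<close> as the \<open>p\<close>-quantile
  of \<open>F\<close>, bounding \<open>T\<close> of the estimator by the right-hand side and taking expectations gives
  the right-hand side for \<open>F\<close>, that is, \<open>T F\<close>.
\<close>

definition real_quantile :: "(real \<Rightarrow> real) \<Rightarrow> real \<Rightarrow> real" where
  "real_quantile G u = real_of_ereal (quantile G u)"

text \<open>For the cdf \<open>G\<close> of a random variable X this is E((X - c)^+). The type
  \<open>ennreal\<close> lets Tonelli apply before finiteness is known.\<close>

definition upper_tail_area :: "(real \<Rightarrow> real) \<Rightarrow> real \<Rightarrow> ennreal" where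
  "upper_tail_area G c = (\<integral>\<^sup>+x. ennreal (1 - G x) * indicator {c..} x \<partial>lborel)"

section \<open>Cdfs, their quantile functions and the area between them\<close>

lemma is_cdf_right_continuous_mono:
  assumes "is_cdf G"
  shows "right_continuous_mono G 0 1"
proof -
  obtain \<mu> where "real_distribution \<mu>" and G: "G = cdf \<mu>"
    using assms by (auto simp: is_cdf_def)
  interpret real_distribution \<mu> by fact
  show ?thesis
    unfolding G by standard
      (auto intro: cdf_is_right_cont cdf_nondecreasing cdf_lim_at_bot cdf_lim_at_top_prob monoI)
qed

lemma is_cdf_bounds:
  assumes "is_cdf G"
  shows "0 \<le> G x" "G x \<le> 1"
proof -
  obtain \<mu> where "real_distribution \<mu>" and G: "G = cdf \<mu>"
    using assms by (auto simp: is_cdf_def)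
  interpret real_distribution \<mu> by fact
  show "0 \<le> G x" "G x \<le> 1"
    unfolding G by (rule cdf_nonneg, rule cdf_bounded_prob)
qed

lemma is_cdf_measurable:
  assumes "is_cdf G"
  shows "G \<in> borel_measurable borel"
  using is_cdf_right_continuous_mono[OF assms]
  by (intro borel_measurable_mono) (simp add: right_continuous_mono_def)

text \<open>Monotonicity, right continuity and the limits 0 and 1 make the points \<open>x\<close>
  with \<open>u \<le> G x\<close> a closed half-line, so the infimum is attained and finite.\<close>

lemma real_quantile_le_iff:
  assumes "is_cdf G" and u: "0 < u" "u < 1"
  shows "real_quantile G u \<le> x \<longleftrightarrow> u \<le> G x"
proof -
  interpret right_continuous_mono G 0 1
    using assms(1) by (rule is_cdf_right_continuous_mono)
  obtain q where q: "\<And>x. u \<le> G x \<longleftrightarrow> q \<le> x"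
    using pseudoinverse[OF u] by blast
  have "quantile G u = (INF x\<in>{q..}. ereal x)"
    using u by (simp add: quantile_def q atLeast_def)
  also have "\<dots> = ereal q"
    by (rule antisym) (auto intro: INF_lower INF_greatest)
  finally show ?thesis
    by (simp add: real_quantile_def q)
qed

lemma real_quantile_mono:
  assumes "is_cdf G" "0 < u" "u \<le> v" "v < 1"
  shows "real_quantile G u \<le> real_quantile G v"
proof -
  have "v \<le> G (real_quantile G v)"
    using real_quantile_le_iff[of G v "real_quantile G v"] assms by simp
  then show ?thesis
    using real_quantile_le_iff[of G u "real_quantile G v"] assms by simp
qed

text \<open>Both sides are the area of the planar region p < u < 1, G x < u, c <= x, whose indicator
  is \<open>h\<close>: the left slices it at fixed \<open>u\<close>, the right at fixed
  \<open>x\<close>. On the left \<open>ennreal\<close> cuts the excess down to its positive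
  part.\<close>

lemma nn_integral_quantile_excess:
  assumes G: "is_cdf G" and p: "0 < p" "p < 1"
  shows "(\<integral>\<^sup>+u. ennreal (real_quantile G u - c) * indicator {p<..<1} u \<partial>lborel)
       = (\<integral>\<^sup>+x. ennreal (1 - max p (G x)) * indicator {c..} x \<partial>lborel)"
proof -
  have [measurable]: "G \<in> borel_measurable borel"
    using G by (rule is_cdf_measurable)
  define h :: "real \<Rightarrow> real \<Rightarrow> ennreal"
    where "h u x = (if p < u \<and> u < 1 \<and> G x < u \<and> c \<le> x then 1 else 0)" for u x
  have [measurable]: "case_prod h \<in> borel_measurable (lborel \<Otimes>\<^sub>M lborel)"
    unfolding h_def by measurable
  have "ennreal (real_quantile G u - c) * indicator {p<..<1} u = (\<integral>\<^sup>+x. h u x \<partial>lborel)" for u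
  proof (cases "p < u \<and> u < 1")
    case True
    \<comment> \<open>By \<open>real_quantile_le_iff\<close>, \<open>G x < u\<close> means that
      \<open>x\<close> lies strictly below the quantile.\<close>
    then have "h u x = indicator {c..<real_quantile G u} x" for x
      using real_quantile_le_iff[OF G, of u x] p by (auto simp: h_def indicator_def not_le[symmetric])
    then have "(\<integral>\<^sup>+x. h u x \<partial>lborel) = emeasure lborel {c..<real_quantile G u}"
      by simp
    also have "\<dots> = ennreal (real_quantile G u - c)"
      by (cases "c \<le> real_quantile G u") (auto simp: ennreal_neg)
    finally show ?thesis
      using True by simp
  qed (auto simp: h_def)
  moreover have "(\<integral>\<^sup>+u. h u x \<partial>lborel) = ennreal (1 - max p (G x)) * indicator {c..} x" for x
  proof (cases "c \<le> x")
    case True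
    then have "h u x = indicator {max p (G x)<..<1} u" for u
      by (auto simp: h_def indicator_def)
    then have "(\<integral>\<^sup>+u. h u x \<partial>lborel) = emeasure lborel {max p (G x)<..<1}"
      by simp
    then show ?thesis
      using True p is_cdf_bounds[OF G, of x] by simp
  qed (auto simp: h_def)
  ultimately show ?thesis
    using lborel_pair.Fubini'[of h] by simp
qed

section \<open>Upper quantile integrals against tail areas\<close>

lemma cdfs_plus_is_cdf: "G \<in> cdfs_plus \<Longrightarrow> is_cdf G"
  by (simp add: cdfs_plus_def)

lemma integrable_quantile_excess:
  assumes "G \<in> cdfs_plus" and p: "0 < p" "p < 1"
  shows "integrable lborel (\<lambda>u. (real_quantile G u - c) * indicator {p<..<1} u)" (is ?int)
    and "(\<integral>u. (real_quantile G u - c) * indicator {p<..<1} u \<partial>lborel)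
       = upper_quantile_integral G p - (1 - p) * c" (is ?eq)
proof -
  have *: "integrable lborel (\<lambda>u. indicator {p<..<1} u * real_quantile G u)"
    using assms by (auto simp: cdfs_plus_def set_integrable_def real_quantile_def)
  have **: "integrable lborel (\<lambda>u. indicator {p<..<1} u * c)"
    using p by (intro integrable_mult_left integrable_real_indicator) auto
  show ?int
    using Bochner_Integration.integrable_diff[OF * **] by (simp add: algebra_simps)
  show ?eq
    using Bochner_Integration.integral_diff[OF * **] p
    by (simp add: algebra_simps upper_quantile_integral_def set_lebesgue_integral_def real_quantile_def)
qed

text \<open>Two losses occur: the excess over \<open>c\<close> is replaced by its positive part, and
  \<open>max p (G x)\<close> by the smaller \<open>G x\<close>.\<close>

lemma upper_quantile_integral_le_tail_area:
  assumes G: "G \<in> cdfs_plus" and p: "0 < p" "p < 1"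
  shows "ennreal (upper_quantile_integral G p - (1 - p) * c) \<le> upper_tail_area G c"
proof -
  let ?f = "\<lambda>u. (real_quantile G u - c) * indicator {p<..<1} u"
  have int: "integrable lborel ?f"
    using assms by (rule integrable_quantile_excess)
  have "upper_quantile_integral G p - (1 - p) * c = integral\<^sup>L lborel ?f"
    using integrable_quantile_excess(2)[OF assms] by simp
  also have "\<dots> \<le> (\<integral>u. max 0 (?f u) \<partial>lborel)"
    using int by (intro integral_mono) auto
  finally have "ennreal (upper_quantile_integral G p - (1 - p) * c)
      \<le> ennreal (\<integral>u. max 0 (?f u) \<partial>lborel)"
    by (rule ennreal_leI)
  also have "\<dots> = (\<integral>\<^sup>+u. max 0 (?f u) \<partial>lborel)"
    using int by (intro nn_integral_eq_integral[symmetric]) auto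
  also have "\<dots> = (\<integral>\<^sup>+u. ennreal (real_quantile G u - c) * indicator {p<..<1} u \<partial>lborel)"
    by (intro nn_integral_cong) (auto simp: indicator_def max_def ennreal_neg)
  also have "\<dots> = (\<integral>\<^sup>+x. ennreal (1 - max p (G x)) * indicator {c..} x \<partial>lborel)"
    using cdfs_plus_is_cdf[OF G] p by (rule nn_integral_quantile_excess)
  also have "\<dots> \<le> upper_tail_area G c"
    unfolding upper_tail_area_def by (intro nn_integral_mono mult_right_mono ennreal_leI) auto
  finally show ?thesis .
qed

text \<open>At the \<open>p\<close>-quantile both losses of the previous bound vanish: for u > p the
  excess is nonnegative by monotonicity, and for x beyond the quantile \<open>p \<le> G x\<close>.
  The second claim ensures that \<open>ennreal\<close> truncates nothing in the first.\<close>

lemma upper_quantile_integral_eq_tail_area: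
  assumes G: "G \<in> cdfs_plus" and p: "0 < p" "p < 1"
  shows "ennreal (upper_quantile_integral G p - (1 - p) * real_quantile G p)
           = upper_tail_area G (real_quantile G p)"
    and "(1 - p) * real_quantile G p \<le> upper_quantile_integral G p"
proof -
  let ?c = "real_quantile G p"
  let ?f = "\<lambda>u. (real_quantile G u - ?c) * indicator {p<..<1} u"
  note cdf = cdfs_plus_is_cdf[OF G]
  have int: "integrable lborel ?f"
    using assms by (rule integrable_quantile_excess)
  have nonneg: "0 \<le> ?f u" for u
    using real_quantile_mono[OF cdf, of p u] p by (auto simp: indicator_def)
  have eq: "upper_quantile_integral G p - (1 - p) * ?c = integral\<^sup>L lborel ?f"
    using integrable_quantile_excess(2)[OF assms] by simp
  have "0 \<le> integral\<^sup>L lborel ?f"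
    using nonneg by (rule Bochner_Integration.integral_nonneg)
  then show "(1 - p) * ?c \<le> upper_quantile_integral G p"
    using eq by linarith
  have "ennreal (upper_quantile_integral G p - (1 - p) * ?c) = (\<integral>\<^sup>+u. ?f u \<partial>lborel)"
    unfolding eq using int nonneg by (intro nn_integral_eq_integral[symmetric]) auto
  also have "\<dots> = (\<integral>\<^sup>+u. ennreal (real_quantile G u - ?c) * indicator {p<..<1} u \<partial>lborel)"
    by (intro nn_integral_cong) (auto simp: indicator_def)
  also have "\<dots> = (\<integral>\<^sup>+x. ennreal (1 - max p (G x)) * indicator {?c..} x \<partial>lborel)"
    using cdf p by (rule nn_integral_quantile_excess)
  also have "\<dots> = upper_tail_area G ?c"
    unfolding upper_tail_area_def using real_quantile_le_iff[OF cdf p]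
    by (intro nn_integral_cong) (auto simp: indicator_def max_def)
  finally show "ennreal (upper_quantile_integral G p - (1 - p) * ?c) = upper_tail_area G ?c" .
qed

section \<open>Measurability over the completion\<close>

text \<open>Preimages under \<open>f\<close> and \<open>g\<close> differ only by a null set, and the
  completion contains every set that agrees almost everywhere with a measurable one.\<close>

lemma borel_measurable_completion_AE_cong:
  fixes f g :: "'a \<Rightarrow> real"
  assumes f[measurable]: "f \<in> borel_measurable (completion M)" and eq: "AE x in completion M. f x = g x"
  shows "g \<in> borel_measurable (completion M)"
proof (rule measurableI)
  fix A :: "real set" assume A: "A \<in> sets borel"
  have "f -` A \<inter> space (completion M) \<in> sets (completion M)"
    using A by measurable
  moreover have "AE x in completion M. x \<in> f -` A \<inter> space (completion M)
      \<longleftrightarrow> x \<in> g -` A \<inter> space (completion M)"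
    using eq by eventually_elim simp
  ultimately show "g -` A \<inter> space (completion M) \<in> sets (completion M)"
    by (rule completion.in_sets_AE[OF _ _ Int_lower2, rotated])
qed simp

lemma measurable_completion_pair:
  assumes "f \<in> M \<Otimes>\<^sub>M N \<rightarrow>\<^sub>M L"
  shows "f \<in> completion M \<Otimes>\<^sub>M N \<rightarrow>\<^sub>M L"
proof -
  have "fst \<in> completion M \<Otimes>\<^sub>M N \<rightarrow>\<^sub>M M"
  proof (rule measurableI)
    fix A assume A: "A \<in> sets M"
    then have "fst -` A \<inter> space (completion M \<Otimes>\<^sub>M N) = A \<times> space N"
      by (auto simp: space_pair_measure dest: sets.sets_into_space)
    then show "fst -` A \<inter> space (completion M \<Otimes>\<^sub>M N) \<in> sets (completion M \<Otimes>\<^sub>M N)"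
      using A by auto
  qed (auto simp: space_pair_measure)
  then have "(\<lambda>z. (fst z, snd z)) \<in> completion M \<Otimes>\<^sub>M N \<rightarrow>\<^sub>M M \<Otimes>\<^sub>M N"
    using measurable_snd by (rule measurable_Pair)
  then have "(\<lambda>z. z) \<in> completion M \<Otimes>\<^sub>M N \<rightarrow>\<^sub>M M \<Otimes>\<^sub>M N"
    by simp
  then show ?thesis
    using assms by (rule measurable_compose[where f = "\<lambda>z. z"])
qed

text \<open>The level \<open>c\<close> may depend on the sample point, because the random
  \<open>p\<close>-quantile will be inserted.\<close>

lemma measurable_upper_tail_area:
  assumes G: "(\<lambda>(\<omega>, x). G \<omega> x) \<in> borel_measurable (M \<Otimes>\<^sub>M borel)"
    and c[measurable]: "c \<in> borel_measurable M"
  shows "(\<lambda>\<omega>. upper_tail_area (G \<omega>) (c \<omega>)) \<in> borel_measurable M"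
proof -
  have [measurable]: "(\<lambda>z. G (fst z) (snd z)) \<in> borel_measurable (M \<Otimes>\<^sub>M lborel)"
    using G by (simp add: case_prod_beta' cong: measurable_cong_sets sets_pair_measure_cong)
  \<comment> \<open>As a comparison, the indicator of a random half-line is visibly jointly
    measurable.\<close>
  have *: "indicator {c \<omega>..} x = (if c \<omega> \<le> x then 1 else 0 :: ennreal)" for \<omega> x
    by simp
  show ?thesis
    unfolding upper_tail_area_def *
    by (rule lborel.borel_measurable_nn_integral) (simp add: case_prod_beta', measurable)
qed

text \<open>The integrand is affine in \<open>G\<close> and nonnegative, so Tonelli moves the
  expectation inside, where unbiasedness at each single \<open>x\<close> suffices.\<close>

lemma nn_integral_upper_tail_area:
  assumes "prob_space M"
    and G: "(\<lambda>(\<omega>, x). G \<omega> x) \<in> borel_measurable (M \<Otimes>\<^sub>M borel)"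
    and bounds: "\<And>\<omega> x. \<omega> \<in> space M \<Longrightarrow> G \<omega> x \<in> {0..1}"
    and mean: "\<And>x. (\<integral>\<omega>. G \<omega> x \<partial>M) = F x"
  shows "(\<integral>\<^sup>+\<omega>. upper_tail_area (G \<omega>) c \<partial>M) = upper_tail_area F c"
proof -
  interpret prob_space M by fact
  interpret pair_sigma_finite M "lborel :: real measure" ..
  have meas[measurable]: "(\<lambda>z. G (fst z) (snd z)) \<in> borel_measurable (M \<Otimes>\<^sub>M lborel)"
    using G by (simp add: case_prod_beta' cong: measurable_cong_sets sets_pair_measure_cong)
  have [measurable]: "(\<lambda>\<omega>. G \<omega> x) \<in> borel_measurable M" for x
    using measurable_compose[OF measurable_Pair2'[of x lborel M] meas] by simp
  have int: "integrable M (\<lambda>\<omega>. G \<omega> x)" for x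
    using bounds by (intro integrable_const_bound[where B = 1]) auto
  have *: "(\<integral>\<^sup>+\<omega>. ennreal (1 - G \<omega> x) \<partial>M) = ennreal (1 - F x)" for x
  proof -
    have "(\<integral>\<^sup>+\<omega>. ennreal (1 - G \<omega> x) \<partial>M) = ennreal (\<integral>\<omega>. 1 - G \<omega> x \<partial>M)"
      using int bounds by (intro nn_integral_eq_integral) auto
    also have "(\<integral>\<omega>. 1 - G \<omega> x \<partial>M) = 1 - F x"
      using int mean by (simp add: prob_space)
    finally show ?thesis .
  qed
  have "(\<integral>\<^sup>+\<omega>. upper_tail_area (G \<omega>) c \<partial>M)
      = (\<integral>\<^sup>+x. (\<integral>\<^sup>+\<omega>. ennreal (1 - G \<omega> x) * indicator {c..} x \<partial>M) \<partial>lborel)"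
    unfolding upper_tail_area_def
    by (rule Fubini'[symmetric]) (simp add: case_prod_beta')
  also have "\<dots> = upper_tail_area F c"
    unfolding upper_tail_area_def by (simp add: nn_integral_multc *)
  finally show ?thesis .
qed

text \<open>The nonnegative integral sees only the positive part of \<open>f\<close>; the minorant
  \<open>g\<close> controls the negative part.\<close>

lemma integrable_sandwich_nn_integral:
  fixes f g :: "'a \<Rightarrow> real"
  assumes f[measurable]: "f \<in> borel_measurable M"
    and g: "integrable M g" and "AE x in M. g x \<le> f x"
    and le: "(\<integral>\<^sup>+x. ennreal (f x) \<partial>M) \<le> ennreal b" and b: "0 \<le> b"
  shows "integrable M f" and "integral\<^sup>L M f \<le> b"
proof -
  have nn: "(\<integral>\<^sup>+x. ennreal (max 0 (f x)) \<partial>M) \<le> ennreal b"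
    using le by (simp add: max.commute)
  then have max: "integrable M (\<lambda>x. max 0 (f x))"
    by (intro integrableI_nonneg) (auto intro: le_less_trans)
  have "AE x in M. norm (f x) \<le> norm (max 0 (f x) + \<bar>g x\<bar>)"
    using \<open>AE x in M. g x \<le> f x\<close> by eventually_elim auto
  then show f: "integrable M f"
    using max g by (intro Bochner_Integration.integrable_bound[of M "\<lambda>x. max 0 (f x) + \<bar>g x\<bar>" f]) auto
  have "integral\<^sup>L M f \<le> (\<integral>x. max 0 (f x) \<partial>M)"
    using f max by (intro integral_mono) auto
  also have "ennreal \<dots> \<le> ennreal b"
    using nn max by (subst nn_integral_eq_integral[symmetric]) auto
  then have "(\<integral>x. max 0 (f x) \<partial>M) \<le> b"
    using b by (simp add: ennreal_le_iff)
  finally show "integral\<^sup>L M f \<le> b" .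
qed

theorem corollary3p2:
  fixes M :: "'a measure"
    and p :: real
    and F :: "real \<Rightarrow> real"
    and Fn :: "nat \<Rightarrow> 'a \<Rightarrow> real \<Rightarrow> real"
  assumes "prob_space M"
    and "p \<in> {0<..<1}"
    and "F \<in> cdfs_plus"
    and "\<And>n. random_cdf M (Fn n)"
    and "\<And>n. AE \<omega> in M. Fn n \<omega> \<in> cdfs_plus"
    and "\<And>n x. expectation_as M (\<lambda>\<omega>. Fn n \<omega> x) = F x"
    and "\<And>n. integrable_as M (\<lambda>\<omega>. real_of_ereal (quantile (Fn n \<omega>) p))"
  shows "\<forall>n. integrable_as M (\<lambda>\<omega>. upper_quantile_integral (Fn n \<omega>) p) \<and>
    expectation_as M (\<lambda>\<omega>. upper_quantile_integral (Fn n \<omega>) p) - upper_quantile_integral F p \<le> 0"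
proof
  fix n
  let ?N = "completion M" and ?c = "real_quantile F p"
  let ?T = "\<lambda>\<omega>. upper_quantile_integral (Fn n \<omega>) p"
    and ?q = "\<lambda>\<omega>. real_quantile (Fn n \<omega>) p"
  interpret prob_space ?N
    by (rule prob_space.prob_space_completion) fact
  have p: "0 < p" "p < 1"
    using assms(2) by auto
  have bounds: "Fn n \<omega> x \<in> {0..1}" if "\<omega> \<in> space ?N" for \<omega> x
    using assms(4)[of n] that by (simp add: random_cdf_def)
  have Fn: "(\<lambda>(\<omega>, x). Fn n \<omega> x) \<in> borel_measurable (?N \<Otimes>\<^sub>M borel)"
    using assms(4)[of n] by (intro measurable_completion_pair) (simp add: random_cdf_def)
  have plus: "AE \<omega> in ?N. Fn n \<omega> \<in> cdfs_plus"
    using assms(5) by (rule AE_completion)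
  have q: "integrable ?N ?q"
    using assms(7) by (simp add: real_quantile_def)
  \<comment> \<open>Measurability of \<open>?T\<close> is obtained from the equality case at the
    random quantile \<open>?q\<close>, which writes \<open>?T\<close> almost surely through
    measurable quantities.\<close>
  have "(\<lambda>\<omega>. (1 - p) * ?q \<omega> + enn2real (upper_tail_area (Fn n \<omega>) (?q \<omega>))) \<in> borel_measurable ?N"
    using measurable_upper_tail_area[OF Fn borel_measurable_integrable[OF q]] q by measurable
  moreover have "AE \<omega> in ?N. (1 - p) * ?q \<omega> + enn2real (upper_tail_area (Fn n \<omega>) (?q \<omega>)) = ?T \<omega>"
    using plus by eventually_elim
      (simp flip: upper_quantile_integral_eq_tail_area(1)
        add: p upper_quantile_integral_eq_tail_area(2))
  ultimately have T[measurable]: "?T \<in> borel_measurable ?N"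
    by (rule borel_measurable_completion_AE_cong)
  let ?b = "upper_quantile_integral F p - (1 - p) * ?c"
  \<comment> \<open>Here the level is the deterministic \<open>?c\<close>, so that the tail area can
    be averaged.\<close>
  have "(\<integral>\<^sup>+\<omega>. ennreal (?T \<omega> - (1 - p) * ?c) \<partial>?N) \<le> (\<integral>\<^sup>+\<omega>. upper_tail_area (Fn n \<omega>) ?c \<partial>?N)"
    using plus by (intro nn_integral_mono_AE, eventually_elim)
      (rule upper_quantile_integral_le_tail_area[OF _ p])
  also have "\<dots> = upper_tail_area F ?c"
    using Fn bounds assms(6) by (intro nn_integral_upper_tail_area prob_space_axioms)
  also have "\<dots> = ennreal ?b"
    using upper_quantile_integral_eq_tail_area(1)[OF assms(3) p] by simp
  finally have le: "(\<integral>\<^sup>+\<omega>. ennreal (?T \<omega> - (1 - p) * ?c) \<partial>?N) \<le> ennreal ?b" .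
  have b: "0 \<le> ?b"
    using upper_quantile_integral_eq_tail_area(2)[OF assms(3) p] by simp
  \<comment> \<open>Integrability of the random quantile enters here: it supplies an integrable
    minorant of \<open>?T\<close>.\<close>
  have lower: "AE \<omega> in ?N. (1 - p) * ?q \<omega> - (1 - p) * ?c \<le> ?T \<omega> - (1 - p) * ?c"
    using plus by eventually_elim (simp add: upper_quantile_integral_eq_tail_area(2) p)
  have int: "integrable ?N (\<lambda>\<omega>. ?T \<omega> - (1 - p) * ?c)"
    and mean: "(\<integral>\<omega>. ?T \<omega> - (1 - p) * ?c \<partial>?N) \<le> ?b"
    using integrable_sandwich_nn_integral[OF _ _ lower le b] q by auto
  have "integrable ?N ?T"
    using Bochner_Integration.integrable_add[OF int, of "\<lambda>_. (1 - p) * ?c"] by simp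
  moreover from this have "(\<integral>\<omega>. ?T \<omega> \<partial>?N) - upper_quantile_integral F p \<le> 0"
    using mean by (simp add: prob_space.prob_space[OF assms(1)])
  ultimately show "integrable ?N ?T \<and> (\<integral>\<omega>. ?T \<omega> \<partial>?N) - upper_quantile_integral F p \<le> 0" ..
qed

end
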